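(* Let $0<\eta<1$ and let $M>0$. Let $\{x_n\}\subset\ell_2$ be a sequence with $\mathcal{R}_\eta(x_n)\le M$ for all $n$, and suppose $\{x_n\}$ converges weakly in $\ell_2$ to $x\in\ell_2$. Then $$\liminf_{n}\mathcal{R}_\eta(x_n)\ \ge\ \mathcal{R}_\eta(x).$$
   Context: $\ell_2$ is the real Hilbert space of square-summable sequences indexed by $\mathbb{N}$, and $\|x\|_{\ell_1}=\sum_i|x_i|\in[0,+\infty]$ for $x\in\ell_2$. The functional $\mathcal{R}_\eta:\ell_2\to[0,+\infty]$ is $\mathcal{R}_\eta(x)=\|x\|_{\ell_1}^2-\eta\|x\|_{\ell_2}^2$, with value $+\infty$ when $x\notin\ell_1$. *)

theory Defs
  imports "HOL-Analysis.Analysis"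
begin

lemma summable_mult_square_summable:
  fixes a b :: "nat \<Rightarrow> real"
  assumes "summable (\<lambda>i. (a i)\<^sup>2)" "summable (\<lambda>i. (b i)\<^sup>2)"
  shows "summable (\<lambda>i. a i * b i)"
proof (rule summable_comparison_test[OF _ summable_add[OF assms]], intro exI allI impI)
  fix i :: nat
  have "2 * \<bar>a i\<bar> * \<bar>b i\<bar> \<le> (a i)\<^sup>2 + (b i)\<^sup>2"
    using sum_squares_bound[of "\<bar>a i\<bar>" "\<bar>b i\<bar>"] by simp
  moreover have "0 \<le> \<bar>a i\<bar> * \<bar>b i\<bar>" by simp
  ultimately show "norm (a i * b i) \<le> (a i)\<^sup>2 + (b i)\<^sup>2"
    unfolding real_norm_def abs_mult by linarith
qed

lemma square_summable_add:
  fixes a b :: "nat \<Rightarrow> real"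
  assumes "summable (\<lambda>i. (a i)\<^sup>2)" "summable (\<lambda>i. (b i)\<^sup>2)"
  shows "summable (\<lambda>i. (a i + b i)\<^sup>2)"
  unfolding power2_sum mult.assoc
  by (intro summable_add summable_mult summable_mult_square_summable assms)


subsection \<open>The real Hilbert space of square-summable sequences\<close>

typedef ell2 = "{a :: nat \<Rightarrow> real. summable (\<lambda>i. (a i)\<^sup>2)}"
  morphisms ell2_nth Abs_ell2
  by (rule exI[of _ "\<lambda>_. 0"]) simp

setup_lifting type_definition_ell2

lemma summable_ell2_nth: "summable (\<lambda>i. (ell2_nth x i)\<^sup>2)"
  using ell2_nth[of x] by simp

lemma summable_ell2_mult: "summable (\<lambda>i. ell2_nth x i * ell2_nth y i)"
  by (intro summable_mult_square_summable summable_ell2_nth)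

lemma ell2_eqI: "(\<And>i. ell2_nth x i = ell2_nth y i) \<Longrightarrow> x = y"
  by (simp add: ell2_nth_inject[symmetric] ext)

instantiation ell2 :: real_vector
begin

lift_definition zero_ell2 :: ell2 is "\<lambda>_. 0"
  by simp

lift_definition plus_ell2 :: "ell2 \<Rightarrow> ell2 \<Rightarrow> ell2" is "\<lambda>a b i. a i + b i"
  by (rule square_summable_add)

lift_definition uminus_ell2 :: "ell2 \<Rightarrow> ell2" is "\<lambda>a i. - a i"
  by simp

lift_definition minus_ell2 :: "ell2 \<Rightarrow> ell2 \<Rightarrow> ell2" is "\<lambda>a b i. a i - b i"
  using square_summable_add[of _ "\<lambda>i. - _ i"] by simp

lift_definition scaleR_ell2 :: "real \<Rightarrow> ell2 \<Rightarrow> ell2" is "\<lambda>c a i. c * a i"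
  by (simp add: power_mult_distrib summable_mult)

instance
  by standard (transfer; simp add: algebra_simps)+

end

lemma ell2_nth_zero [simp]: "ell2_nth 0 i = 0"
  and ell2_nth_add [simp]: "ell2_nth (x + y) i = ell2_nth x i + ell2_nth y i"
  and ell2_nth_minus [simp]: "ell2_nth (- x) i = - ell2_nth x i"
  and ell2_nth_diff [simp]: "ell2_nth (x - y) i = ell2_nth x i - ell2_nth y i"
  and ell2_nth_scaleR [simp]: "ell2_nth (c *\<^sub>R x) i = c * ell2_nth x i"
  by (simp_all add: zero_ell2.rep_eq plus_ell2.rep_eq uminus_ell2.rep_eq
      minus_ell2.rep_eq scaleR_ell2.rep_eq)

instantiation ell2 :: real_inner
begin

definition inner_ell2 :: "ell2 \<Rightarrow> ell2 \<Rightarrow> real" where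
  "inner_ell2 x y = (\<Sum>i. ell2_nth x i * ell2_nth y i)"

definition norm_ell2 :: "ell2 \<Rightarrow> real" where
  "norm_ell2 x = sqrt (\<Sum>i. (ell2_nth x i)\<^sup>2)"

definition sgn_ell2 :: "ell2 \<Rightarrow> ell2" where
  "sgn_ell2 x = x /\<^sub>R norm x"

definition dist_ell2 :: "ell2 \<Rightarrow> ell2 \<Rightarrow> real" where
  "dist_ell2 x y = norm (x - y)"

definition uniformity_ell2 :: "(ell2 \<times> ell2) filter" where
  "uniformity_ell2 = (INF e\<in>{0<..}. principal {(x, y). dist x y < e})"

definition open_ell2 :: "ell2 set \<Rightarrow> bool" where
  "open_ell2 U \<longleftrightarrow> (\<forall>x\<in>U. \<forall>\<^sub>F (x', y) in uniformity. x' = x \<longrightarrow> y \<in> U)"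

instance
proof
  fix x y z :: ell2 and r :: real and U :: "ell2 set"
  show "dist x y = norm (x - y)" by (rule dist_ell2_def)
  show "sgn x = x /\<^sub>R norm x" by (rule sgn_ell2_def)
  show "(uniformity :: (ell2 \<times> ell2) filter) = (INF e\<in>{0<..}. principal {(x, y). dist x y < e})"
    by (rule uniformity_ell2_def)
  show "open U \<longleftrightarrow> (\<forall>x\<in>U. \<forall>\<^sub>F (x', y) in uniformity. x' = x \<longrightarrow> y \<in> U)"
    by (rule open_ell2_def)
  show "x \<bullet> y = y \<bullet> x"
    by (simp add: inner_ell2_def mult.commute)
  show "(x + y) \<bullet> z = x \<bullet> z + y \<bullet> z"
    by (simp add: inner_ell2_def distrib_right suminf_add summable_ell2_mult)
  show "(r *\<^sub>R x) \<bullet> y = r * (x \<bullet> y)"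
    by (simp add: inner_ell2_def mult.assoc suminf_mult summable_ell2_mult)
  show "0 \<le> x \<bullet> x"
    unfolding inner_ell2_def by (intro suminf_nonneg summable_ell2_mult) simp
  show "(x \<bullet> x = 0) = (x = 0)"
    unfolding inner_ell2_def
    by (subst suminf_eq_zero_iff[OF summable_ell2_mult]) (auto intro: ell2_eqI)
  show "norm x = sqrt (x \<bullet> x)"
    by (simp add: norm_ell2_def inner_ell2_def power2_eq_square)
qed

end

lemma norm_ell2_le:
  fixes x :: ell2
  assumes "\<And>N. (\<Sum>i<N. (ell2_nth x i)\<^sup>2) \<le> e\<^sup>2" "0 \<le> e"
  shows "norm x \<le> e"
proof -
  have "(\<Sum>i. (ell2_nth x i)\<^sup>2) \<le> e\<^sup>2"
    using assms(1) by (intro suminf_le_const summable_ell2_nth) auto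
  then show ?thesis
    unfolding norm_ell2_def using assms(2) by (simp add: real_le_lsqrt)
qed

lemma sum_ell2_nth_le_norm:
  fixes x :: ell2
  shows "(\<Sum>i<N. (ell2_nth x i)\<^sup>2) \<le> (norm x)\<^sup>2"
proof -
  have "(norm x)\<^sup>2 = (\<Sum>i. (ell2_nth x i)\<^sup>2)"
    by (simp add: norm_ell2_def suminf_nonneg summable_ell2_nth)
  then show ?thesis
    by (simp add: sum_le_suminf summable_ell2_nth)
qed

lemma abs_ell2_nth_le_norm: "\<bar>ell2_nth x i\<bar> \<le> norm x"
proof -
  have "(ell2_nth x i)\<^sup>2 \<le> (\<Sum>j<Suc i. (ell2_nth x j)\<^sup>2)"
    by (simp add: sum_nonneg)
  also have "\<dots> \<le> (norm x)\<^sup>2" by (rule sum_ell2_nth_le_norm)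
  finally show ?thesis by (simp add: abs_le_square_iff[symmetric])
qed

instance ell2 :: complete_space
proof
  fix X :: "nat \<Rightarrow> ell2"
  assume X: "Cauchy X"
  have "Cauchy (\<lambda>n. ell2_nth (X n) i)" for i
  proof (rule CauchyI)
    fix e :: real assume "0 < e"
    then obtain K where K: "\<And>m n. m \<ge> K \<Longrightarrow> n \<ge> K \<Longrightarrow> norm (X m - X n) < e"
      using CauchyD[OF X] by blast
    have "norm (ell2_nth (X m) i - ell2_nth (X n) i) < e" if "m \<ge> K" "n \<ge> K" for m n
      using abs_ell2_nth_le_norm[of "X m - X n" i] K[OF that] by simp
    then show "\<exists>K. \<forall>m\<ge>K. \<forall>n\<ge>K. norm (ell2_nth (X m) i - ell2_nth (X n) i) < e"
      by blast
  qed
  then obtain a where a: "\<And>i. (\<lambda>n. ell2_nth (X n) i) \<longlonglongrightarrow> a i"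
    unfolding Cauchy_convergent_iff convergent_def by metis
  have tail: "\<exists>K. \<forall>m\<ge>K. \<forall>N. (\<Sum>i<N. (ell2_nth (X m) i - a i)\<^sup>2) \<le> e\<^sup>2" if e: "0 < e" for e
  proof -
    obtain K where K: "\<And>m n. m \<ge> K \<Longrightarrow> n \<ge> K \<Longrightarrow> norm (X m - X n) < e"
      using CauchyD[OF X e] by blast
    have "(\<Sum>i<N. (ell2_nth (X m) i - a i)\<^sup>2) \<le> e\<^sup>2" if m: "m \<ge> K" for m N
    proof (rule LIMSEQ_le_const2)
      show "(\<lambda>n. \<Sum>i<N. (ell2_nth (X m) i - ell2_nth (X n) i)\<^sup>2)
          \<longlonglongrightarrow> (\<Sum>i<N. (ell2_nth (X m) i - a i)\<^sup>2)"
        by (intro tendsto_intros a)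
      have "(\<Sum>i<N. (ell2_nth (X m) i - ell2_nth (X n) i)\<^sup>2) \<le> e\<^sup>2" if n: "n \<ge> K" for n
        using sum_ell2_nth_le_norm[where N=N and x="X m - X n"]
              power_mono[OF less_imp_le[OF K[OF m n]] norm_ge_zero, of 2]
        by simp
      then show "\<exists>N'. \<forall>n\<ge>N'. (\<Sum>i<N. (ell2_nth (X m) i - ell2_nth (X n) i)\<^sup>2) \<le> e\<^sup>2"
        by blast
    qed
    then show ?thesis by blast
  qed
  obtain K where K: "\<And>N. (\<Sum>i<N. (ell2_nth (X K) i - a i)\<^sup>2) \<le> 1\<^sup>2"
    using tail[of 1] by auto
  have "summable (\<lambda>i. (ell2_nth (X K) i - a i)\<^sup>2)"
    by (rule summableI_nonneg_bounded[OF _ K]) simp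
  then have "summable (\<lambda>i. (a i - ell2_nth (X K) i)\<^sup>2)"
    by (simp add: power2_commute)
  from square_summable_add[OF this summable_ell2_nth[of "X K"]]
  have "summable (\<lambda>i. (a i)\<^sup>2)" by simp
  then obtain x where x: "ell2_nth x = a"
    using Abs_ell2_inverse[of a] by blast
  have "X \<longlonglongrightarrow> x"
  proof (rule LIMSEQ_I)
    fix e :: real assume e: "0 < e"
    then obtain K where K: "\<And>m N. m \<ge> K \<Longrightarrow> (\<Sum>i<N. (ell2_nth (X m) i - a i)\<^sup>2) \<le> (e / 2)\<^sup>2"
      using tail[of "e / 2"] by auto
    have "norm (X m - x) < e" if "m \<ge> K" for m
    proof -
      have "norm (X m - x) \<le> e / 2"
        using K[OF that] e by (intro norm_ell2_le) (simp_all add: x)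
      then show ?thesis using e by simp
    qed
    then show "\<exists>K. \<forall>m\<ge>K. norm (X m - x) < e" by blast
  qed
  then show "convergent X" by (rule convergentI)
qed


subsection \<open>Weak convergence and the functional\<close>

definition weakly_tendsto :: "(nat \<Rightarrow> 'a::real_normed_vector) \<Rightarrow> 'a \<Rightarrow> bool" where
  "weakly_tendsto X x \<longleftrightarrow>
     (\<forall>f :: 'a \<Rightarrow> real. bounded_linear f \<longrightarrow> (\<lambda>n. f (X n)) \<longlonglongrightarrow> f x)"

definition l1_norm :: "ell2 \<Rightarrow> ereal" where
  "l1_norm x = (\<Sum>i. ereal \<bar>ell2_nth x i\<bar>)"

text \<open>Outside \<open>\<ell>\<^sub>1\<close> the value is \<open>\<infinity>\<close>: then \<open>l1_norm x = \<infinity>\<close>, and in \<^typ>\<open>ereal\<close> \<open>\<infinity>\<^sup>2 - c = \<infinity>\<close>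
  for every real \<open>c\<close>; see \<open>R_functional_eq\<close> below.\<close>

definition R_functional :: "real \<Rightarrow> ell2 \<Rightarrow> ereal" where
  "R_functional \<eta> x = (l1_norm x)\<^sup>2 - ereal (\<eta> * (norm x)\<^sup>2)"

lemma R_functional_eq:
  "R_functional \<eta> x =
     (if summable (\<lambda>i. \<bar>ell2_nth x i\<bar>)
      then ereal ((\<Sum>i. \<bar>ell2_nth x i\<bar>)\<^sup>2 - \<eta> * (norm x)\<^sup>2) else \<infinity>)"
proof (cases "summable (\<lambda>i. \<bar>ell2_nth x i\<bar>)")
  case True
  then have "l1_norm x = ereal (\<Sum>i. \<bar>ell2_nth x i\<bar>)"
    unfolding l1_norm_def by (intro suminf_ereal')
  then show ?thesis using True by (simp add: R_functional_def)
next
  case False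
  have "l1_norm x = \<infinity>"
    using summable_ereal[of "\<lambda>i. \<bar>ell2_nth x i\<bar>"] False unfolding l1_norm_def by auto
  then show ?thesis using False by (simp add: R_functional_def)
qed

end

theory Submission
  imports Defs
begin

text \<open>The functional \<open>R_functional \<eta>\<close> is a supremum of weakly continuous functions, hence
  weakly lower semicontinuous. The functions are its truncations to the first \<open>N\<close> coordinates.
  Each one is a continuous function of finitely many coordinates, and coordinates are bounded
  linear functionals. That the truncations increase with \<open>N\<close> is where \<open>\<eta> \<le> 1\<close> enters: a new
  coordinate of modulus \<open>t\<close> adds \<open>2 s t + t\<^sup>2 \<ge> t\<^sup>2\<close> to the squared \<open>\<ell>\<^sub>1\<close> part, where
  \<open>s \<ge> 0\<close> is the previous sum, and so outweighs the \<open>\<eta> t\<^sup>2\<close> that is subtracted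
  (\<open>R_trunc_mono\<close>). The negative term \<open>- \<eta> \<parallel>x\<parallel>\<^sup>2\<close>, which is only weakly \<^emph>\<open>upper\<close>
  semicontinuous on its own, is thus absorbed coordinate by coordinate.\<close>

definition R_trunc :: "real \<Rightarrow> nat \<Rightarrow> ell2 \<Rightarrow> real" where
  "R_trunc \<eta> N x = (\<Sum>i<N. \<bar>ell2_nth x i\<bar>)\<^sup>2 - \<eta> * (\<Sum>i<N. (ell2_nth x i)\<^sup>2)"

lemma R_trunc_mono:
  assumes "\<eta> \<le> 1"
  shows "mono (\<lambda>N. R_trunc \<eta> N x)"
proof (rule incseq_SucI)
  fix N
  define s t where "s = (\<Sum>i<N. \<bar>ell2_nth x i\<bar>)" and "t = \<bar>ell2_nth x N\<bar>"
  have "0 \<le> s * t" by (simp add: s_def t_def sum_nonneg)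
  moreover have "\<eta> * t\<^sup>2 \<le> t\<^sup>2" using mult_right_mono[OF assms, of "t\<^sup>2"] by simp
  ultimately have "s\<^sup>2 \<le> (s + t)\<^sup>2 - \<eta> * t\<^sup>2"
    by (simp add: power2_sum)
  then show "R_trunc \<eta> N x \<le> R_trunc \<eta> (Suc N) x"
    by (simp add: R_trunc_def s_def t_def distrib_left)
qed

text \<open>The limit is taken in the extended reals, so that it also covers \<open>x \<notin> \<ell>\<^sub>1\<close>; there the
  subtracted part stays bounded while the partial \<open>\<ell>\<^sub>1\<close> sums diverge.\<close>

lemma R_trunc_tendsto_R_functional:
  "(\<lambda>N. ereal (R_trunc \<eta> N x)) \<longlonglongrightarrow> R_functional \<eta> x"
proof -
  have "(\<lambda>N. \<Sum>i<N. ereal \<bar>ell2_nth x i\<bar>) \<longlonglongrightarrow> l1_norm x"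
    unfolding l1_norm_def by (intro summable_LIMSEQ summable_ereal_pos) simp
  then have l1: "(\<lambda>N. ereal (\<Sum>i<N. \<bar>ell2_nth x i\<bar>)) \<longlonglongrightarrow> l1_norm x"
    by simp
  \<comment> \<open>Multiplication of extended reals is continuous away from \<open>0 * \<infinity>\<close>, which a square avoids.\<close>
  have l1_sq: "(\<lambda>N. (ereal (\<Sum>i<N. \<bar>ell2_nth x i\<bar>))\<^sup>2) \<longlonglongrightarrow> (l1_norm x)\<^sup>2"
    unfolding power2_eq_square by (rule tendsto_mult_ereal[OF l1 l1]) auto
  have "(norm x)\<^sup>2 = (\<Sum>i. (ell2_nth x i)\<^sup>2)"
    by (simp add: norm_ell2_def suminf_nonneg summable_ell2_nth)
  then have "(\<lambda>N. \<Sum>i<N. (ell2_nth x i)\<^sup>2) \<longlonglongrightarrow> (norm x)\<^sup>2"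
    using summable_LIMSEQ[OF summable_ell2_nth] by simp
  then have "(\<lambda>N. ereal (\<eta> * (\<Sum>i<N. (ell2_nth x i)\<^sup>2))) \<longlonglongrightarrow> ereal (\<eta> * (norm x)\<^sup>2)"
    by (intro tendsto_intros)
  then have "(\<lambda>N. (ereal (\<Sum>i<N. \<bar>ell2_nth x i\<bar>))\<^sup>2 - ereal (\<eta> * (\<Sum>i<N. (ell2_nth x i)\<^sup>2)))
      \<longlonglongrightarrow> R_functional \<eta> x"
    unfolding R_functional_def by (intro tendsto_diff_ereal_general l1_sq) auto
  then show ?thesis
    by (simp add: R_trunc_def)
qed

corollary R_trunc_le_R_functional:
  assumes "\<eta> \<le> 1"
  shows "ereal (R_trunc \<eta> N x) \<le> R_functional \<eta> x"
proof (rule incseq_le[OF _ R_trunc_tendsto_R_functional])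
  show "incseq (\<lambda>N. ereal (R_trunc \<eta> N x))"
    using R_trunc_mono[OF assms] by (simp add: mono_def)
qed

lemma bounded_linear_ell2_nth: "bounded_linear (\<lambda>x. ell2_nth x i)"
  by (rule bounded_linear_intro[where K = 1]) (simp_all add: abs_ell2_nth_le_norm)

lemma R_trunc_weakly_continuous:
  assumes "weakly_tendsto X x"
  shows "(\<lambda>n. R_trunc \<eta> N (X n)) \<longlonglongrightarrow> R_trunc \<eta> N x"
proof -
  have "(\<lambda>n. ell2_nth (X n) i) \<longlonglongrightarrow> ell2_nth x i" for i
    using assms bounded_linear_ell2_nth unfolding weakly_tendsto_def by blast
  then show ?thesis
    unfolding R_trunc_def by (intro tendsto_intros)
qed

theorem lemma2p7:
  fixes \<eta> M :: real and X :: "nat \<Rightarrow> ell2" and x :: ell2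
  assumes "0 < \<eta>" and "\<eta> < 1" and "M > 0"
    and "\<And>n. R_functional \<eta> (X n) \<le> ereal M"
    and "weakly_tendsto X x"
  shows "liminf (\<lambda>n. R_functional \<eta> (X n)) \<ge> R_functional \<eta> x"
proof (rule LIMSEQ_le_const2[OF R_trunc_tendsto_R_functional], intro exI allI impI)
  fix N
  have "(\<lambda>n. ereal (R_trunc \<eta> N (X n))) \<longlonglongrightarrow> ereal (R_trunc \<eta> N x)"
    using R_trunc_weakly_continuous[OF assms(5)] by (intro tendsto_intros)
  then have "ereal (R_trunc \<eta> N x) = liminf (\<lambda>n. ereal (R_trunc \<eta> N (X n)))"
    by (rule lim_imp_Liminf[OF sequentially_bot, symmetric])
  also have "\<dots> \<le> liminf (\<lambda>n. R_functional \<eta> (X n))"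
    using assms(2) by (intro Liminf_mono always_eventually allI R_trunc_le_R_functional) simp
  finally show "ereal (R_trunc \<eta> N x) \<le> liminf (\<lambda>n. R_functional \<eta> (X n))" .
qed

end
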